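(* Let $G=(V,E,\{\pm1\},\{\pi_{v\to u}\}_{(u,v)\in E})$ be a \textsc{StrongUniqueGames} instance over alphabet $\{\pm1\}$ whose constraint graph has degree bounded by $d$. Then there exists an efficient procedure that, given $G$, outputs a \textsc{StrongUniqueGames} instance $\psi(V',E',\{\pm1\},\{\pi_{e,v}\})$ such that for any $\epsilon,\gamma\in(0,1)$: \begin{itemize} \item if $\mathrm{sval}(G)\geq 1-\epsilon$ then $\mathrm{sval}(\psi)\geq 1-\epsilon$; \item if $\mathrm{sval}(\psi)\geq 1-\gamma$ then $\mathrm{sval}(G)\geq 1-2\gamma$. \end{itemize} Additionally, the degree of the constraint graph of $\psi$ is bounded by $d+1$, and all constraints in $\psi$ are NEQ constraints.
   Context: Over alphabet $\{\pm1\}$, every bijection constraint on an edge $(u,v)$ is either an EQ constraint ($\sigma(u)=\sigma(v)$) or a NEQ constraint ($\sigma(u)\neq\sigma(v)$). $\mathrm{sval}$ of an instance on vertex set $V$ is $|S|/|V|$ for a largest $S\subseteq V$ such that some labeling satisfies all constraints on edges with both endpoints in $S$. *)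

theory Defs
  imports Complex_Main "HOL-Library.FuncSet" "HOL-Computational_Algebra.Polynomial"
begin

section \<open>Strong unique games\<close>

text \<open>
  The constraint graph is a simple undirected graph, its edge set being a symmetric irreflexive
  set of ordered pairs. The function \<open>perm G v u\<close> is the bijection \<open>\<pi>\<^bsub>v\<rightarrow>u\<^esub>\<close>, which sends the label
  of \<open>v\<close> to the label required at \<open>u\<close>; it is meaningful only for \<open>(u, v) \<in> edges G\<close> and on the
  alphabet.
\<close>

record ('v, 'a) unique_games =
  verts :: "'v set"
  edges :: "('v \<times> 'v) set"
  alphabet :: "'a set"
  perm :: "'v \<Rightarrow> 'v \<Rightarrow> 'a \<Rightarrow> 'a"

definition ug_instance :: "('v, 'a) unique_games \<Rightarrow> bool" where
  "ug_instance G \<longleftrightarrow>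
     finite (verts G) \<and> verts G \<noteq> {} \<and>
     edges G \<subseteq> verts G \<times> verts G \<and> sym (edges G) \<and> irrefl (edges G) \<and>
     finite (alphabet G) \<and> alphabet G \<noteq> {} \<and>
     (\<forall>(u, v) \<in> edges G.
        bij_betw (perm G v u) (alphabet G) (alphabet G) \<and>
        (\<forall>a \<in> alphabet G. perm G u v (perm G v u a) = a))"

definition vertex_degree :: "('v, 'a) unique_games \<Rightarrow> 'v \<Rightarrow> nat" where
  "vertex_degree G v = card {u. (u, v) \<in> edges G}"

definition degree_bounded_by :: "('v, 'a) unique_games \<Rightarrow> nat \<Rightarrow> bool" where
  "degree_bounded_by G d \<longleftrightarrow> (\<forall>v \<in> verts G. vertex_degree G v \<le> d)"

text \<open>The constraint on \<open>(u, v)\<close> accepts labels \<open>a\<close> of \<open>u\<close> and \<open>b\<close> of \<open>v\<close>.\<close>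

definition accepts :: "('v, 'a) unique_games \<Rightarrow> 'v \<Rightarrow> 'v \<Rightarrow> 'a \<Rightarrow> 'a \<Rightarrow> bool" where
  "accepts G u v a b \<longleftrightarrow> a = perm G v u b"

definition eq_constraint :: "('v, 'a) unique_games \<Rightarrow> 'v \<Rightarrow> 'v \<Rightarrow> bool" where
  "eq_constraint G u v \<longleftrightarrow> (\<forall>a \<in> alphabet G. \<forall>b \<in> alphabet G. accepts G u v a b \<longleftrightarrow> a = b)"

definition neq_constraint :: "('v, 'a) unique_games \<Rightarrow> 'v \<Rightarrow> 'v \<Rightarrow> bool" where
  "neq_constraint G u v \<longleftrightarrow> (\<forall>a \<in> alphabet G. \<forall>b \<in> alphabet G. accepts G u v a b \<longleftrightarrow> a \<noteq> b)"

definition strongly_satisfiable :: "('v, 'a) unique_games \<Rightarrow> 'v set \<Rightarrow> bool" where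
  "strongly_satisfiable G S \<longleftrightarrow>
     (\<exists>\<sigma> \<in> verts G \<rightarrow> alphabet G.
        \<forall>(u, v) \<in> edges G. u \<in> S \<and> v \<in> S \<longrightarrow> accepts G u v (\<sigma> u) (\<sigma> v))"

definition sval :: "('v, 'a) unique_games \<Rightarrow> real" where
  "sval G = Max {real (card S) / real (card (verts G)) | S.
                   S \<subseteq> verts G \<and> strongly_satisfiable G S}"


section \<open>Polynomial-time computation\<close>

text \<open>
  Deterministic multi-tape Turing machines. Tapes are two-way infinite, and a cell is blank
  (\<open>None\<close>) or carries a symbol of the finite type \<open>'s\<close>. The states are \<open>{0..n_states M}\<close>; state
  \<open>0\<close> is initial and state \<open>n_states M\<close> is the halting state. The transition function receives
  the list of scanned symbols and returns, for every tape, the symbol to write and the head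
  movement. The input is written on the first tape, and the output is read off the last one.
\<close>

datatype move = Left | Stay | Right

primrec offset :: "move \<Rightarrow> int" where
  "offset Left = -1"
| "offset Stay = 0"
| "offset Right = 1"

record 's tm =
  n_tapes :: nat
  n_states :: nat
  delta :: "nat \<Rightarrow> 's option list \<Rightarrow> nat \<times> ('s option \<times> move) list"

definition wf_tm :: "('s::finite) tm \<Rightarrow> bool" where
  "wf_tm M \<longleftrightarrow> n_tapes M \<ge> 1 \<and>
     (\<forall>q < n_states M. \<forall>ss. length ss = n_tapes M \<longrightarrow>
        fst (delta M q ss) \<le> n_states M \<and> length (snd (delta M q ss)) = n_tapes M)"

type_synonym 's tape = "int \<Rightarrow> 's option"
type_synonym 's config = "nat \<times> (int \<times> 's tape) list"

definition tape_of :: "'s list \<Rightarrow> 's tape" where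
  "tape_of w = (\<lambda>i. if 0 \<le> i \<and> i < int (length w) then Some (w ! nat i) else None)"

definition tm_init :: "'s tm \<Rightarrow> 's list \<Rightarrow> 's config" where
  "tm_init M w = (0, map (\<lambda>i. (0, tape_of (if i = 0 then w else []))) [0..<n_tapes M])"

definition tm_step :: "'s tm \<Rightarrow> 's config \<Rightarrow> 's config" where
  "tm_step M c =
     (let (q, ts) = c in
      if q = n_states M then c
      else
        let (q', as) = delta M q (map (\<lambda>(h, t). t h) ts)
        in (q', map2 (\<lambda>(h, t) (s, m). (h + offset m, t(h := s))) ts as))"

definition tm_computes :: "'s tm \<Rightarrow> 's list \<Rightarrow> nat \<Rightarrow> 's list \<Rightarrow> bool" where
  "tm_computes M w T w' \<longleftrightarrow>
     (\<exists>t \<le> T. let (q, ts) = (tm_step M ^^ t) (tm_init M w)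
              in q = n_states M \<and> snd (last ts) = tape_of w')"

text \<open>
  A map \<open>f\<close> on the objects satisfying \<open>D\<close> is computable in polynomial time with respect to a
  representation \<open>rep\<close> of objects by strings (an object may have several representations) if
  some machine turns every representation of every \<open>x\<close> in \<open>D\<close> into a representation of \<open>f x\<close>
  in time polynomial in the length of its input.
\<close>

definition polytime_computable ::
  "(('s::finite) list \<Rightarrow> 'x \<Rightarrow> bool) \<Rightarrow> ('x \<Rightarrow> bool) \<Rightarrow> ('x \<Rightarrow> 'x) \<Rightarrow> bool" where
  "polytime_computable rep D f \<longleftrightarrow>
     (\<exists>M (p :: nat poly). wf_tm M \<and>
        (\<forall>x w. D x \<and> rep w x \<longrightarrow>
           (\<exists>w'. tm_computes M w (poly p (length w)) w' \<and> rep w' (f x))))"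


section \<open>Representing instances over the alphabet of signs by strings\<close>

text \<open>
  To be handed to an algorithm, the vertices are named by binary strings. An instance is
  represented by a list of its vertices followed by a list of its edges, in any order and
  without repetitions. Every edge occurs in both orientations, marked by the kind of its
  constraint.
\<close>

type_synonym pm_game = "(bool list, int) unique_games"

definition pm_instance :: "pm_game \<Rightarrow> bool" where
  "pm_instance G \<longleftrightarrow> ug_instance G \<and> alphabet G = {1, -1}"

datatype symbol = Zero | One | Stop | Vertex | Edge_EQ | Edge_NEQ

instance symbol :: finite
proof
  have "(UNIV :: symbol set) = {Zero, One, Stop, Vertex, Edge_EQ, Edge_NEQ}"
    using symbol.exhaust by blast
  then show "finite (UNIV :: symbol set)"
    by (metis finite.emptyI finite_insert)
qed

definition name_code :: "bool list \<Rightarrow> symbol list" where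
  "name_code v = map (\<lambda>b. if b then One else Zero) v @ [Stop]"

definition vertex_code :: "bool list \<Rightarrow> symbol list" where
  "vertex_code v = Vertex # name_code v"

definition edge_code :: "pm_game \<Rightarrow> bool list \<times> bool list \<Rightarrow> symbol list" where
  "edge_code G e =
     (let (u, v) = e
      in (if eq_constraint G u v then Edge_EQ else Edge_NEQ) # name_code u @ name_code v)"

definition represents :: "symbol list \<Rightarrow> pm_game \<Rightarrow> bool" where
  "represents w G \<longleftrightarrow>
     (\<exists>vs es. distinct vs \<and> set vs = verts G \<and> distinct es \<and> set es = edges G \<and>
        w = concat (map vertex_code vs) @ concat (map (edge_code G) es))"

definition efficient_procedure :: "(pm_game \<Rightarrow> pm_game) \<Rightarrow> bool" where
  "efficient_procedure \<psi> \<longleftrightarrow> polytime_computable represents pm_instance \<psi>"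

end

theory Submission
  imports Defs
begin

text \<open>
  Every vertex \<open>v\<close> is replaced by two copies \<open>False # v\<close> and \<open>True # v\<close> joined by a NEQ edge, so that
  the second copy carries the negated label. A NEQ edge joins copies of equal index and an EQ edge
  copies of opposite index. A subset of \<open>V\<close> lifts to the set of all its copies, and a subset of the
  doubled vertex set missing at most \<open>2 * \<gamma> * card V\<close> copies contains both copies of all but
  \<open>2 * \<gamma> * card V\<close> vertices of \<open>V\<close>. A two-way transducer writes the doubled instance in four
  passes over the input: the copies of index \<open>False\<close>, those of index \<open>True\<close>, and then the edges
  starting at copies of index \<open>False\<close> and of index \<open>True\<close>. The edge between the copies of \<open>v\<close>
  contains the name \<open>v\<close> twice, for which the transducer steps back once.
\<close>

section \<open>The doubled instance\<close>

text \<open>\<open>b\<close> is the index of the copy at which the edge starts. As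
  \<open>edges G\<close> holds both orientations, letting \<open>b\<close> take both values yields
  both orientations of every lifted edge.\<close>

definition double_edge :: "pm_game \<Rightarrow> bool \<Rightarrow> bool list \<times> bool list \<Rightarrow> bool list \<times> bool list" where
  "double_edge G b = (\<lambda>(u, v). (b # u, (if eq_constraint G u v then \<not> b else b) # v))"

definition copy_edge :: "bool \<Rightarrow> bool list \<Rightarrow> bool list \<times> bool list" where
  "copy_edge b v = (b # v, (\<not> b) # v)"

definition double :: "pm_game \<Rightarrow> pm_game" where
  "double G = \<lparr>
     verts = (\<Union>b. Cons b ` verts G),
     edges = (\<Union>b. copy_edge b ` verts G \<union> double_edge G b ` edges G),
     alphabet = {1, -1},
     perm = (\<lambda>_ _ a. - a) \<rparr>"

lemma double_simps [simp]:
  "b # v \<in> verts (double G) \<longleftrightarrow> v \<in> verts G"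
  "[] \<notin> verts (double G)"
  "alphabet (double G) = {1, -1}"
  "perm (double G) x y a = - a"
  by (auto simp: double_def)

lemma double_edges_iff:
  "(b # u, c # v) \<in> edges (double G) \<longleftrightarrow>
     (u = v \<and> v \<in> verts G \<and> c \<noteq> b) \<or>
     ((u, v) \<in> edges G \<and> (c \<noteq> b \<longleftrightarrow> eq_constraint G u v))"
proof -
  have "(b # u, c # v) \<in> copy_edge b' ` verts G \<longleftrightarrow> b' = b \<and> u = v \<and> v \<in> verts G \<and> c = (\<not> b)" for b'
    by (auto simp: copy_edge_def)
  moreover have "(b # u, c # v) \<in> double_edge G b' ` edges G \<longleftrightarrow>
      b' = b \<and> (u, v) \<in> edges G \<and> c = (if eq_constraint G u v then \<not> b else b)" for b'
    by (force simp: double_edge_def)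
  ultimately show ?thesis
    by (cases b; cases c) (auto simp: double_def)
qed

lemma double_edgesE:
  assumes "(x, y) \<in> edges (double G)"
  obtains b u c v where "x = b # u" "y = c # v"
  using assms by (auto simp: double_def copy_edge_def double_edge_def)

text \<open>A bijection of a two-element set is the identity or the swap, so being EQ or not decides
  which pairs of signs are accepted.\<close>

lemma pm_accepts_iff:
  assumes "pm_instance G" "(u, v) \<in> edges G" "a \<in> {1, -1}" "b \<in> {1, -1}"
  shows "accepts G u v a b \<longleftrightarrow> (a = b \<longleftrightarrow> eq_constraint G u v)"
proof -
  let ?p = "perm G v u"
  have bij: "bij_betw ?p {1, -1} {1, -1}"
    using assms(1,2) by (auto simp: pm_instance_def ug_instance_def)
  then have "?p 1 \<in> {1, -1}" "?p (-1) \<in> {1, -1}" "?p 1 \<noteq> ?p (-1)"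
    by (auto simp: bij_betw_def inj_on_def)
  then consider "?p 1 = 1" "?p (-1) = -1" | "?p 1 = -1" "?p (-1) = 1" by auto
  moreover have "alphabet G = {1, -1}" using assms(1) by (simp add: pm_instance_def)
  moreover have "a = 1 \<or> a = -1" "b = 1 \<or> b = -1" using assms(3,4) by auto
  ultimately show ?thesis
    unfolding accepts_def eq_constraint_def by cases (elim disjE; simp)+
qed

text \<open>The bijections of the two orientations are mutually inverse and so accept the same
  pairs; the pair \<open>1\<close>, \<open>1\<close> already tells EQ from NEQ. This makes the
  doubled edge set symmetric.\<close>

lemma eq_constraint_commute:
  assumes "pm_instance G" "(u, v) \<in> edges G"
  shows "eq_constraint G u v \<longleftrightarrow> eq_constraint G v u"
proof -
  have vu: "(v, u) \<in> edges G"
    using assms by (auto simp: pm_instance_def ug_instance_def dest: symD)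
  have "accepts G u v a b \<longleftrightarrow> accepts G v u b a" if "a \<in> {1, -1}" "b \<in> {1, -1}" for a b
  proof -
    have "perm G u v (perm G v u a) = a" "perm G v u (perm G u v a) = a" if "a \<in> {1, -1}" for a
      using assms vu that by (auto simp: pm_instance_def ug_instance_def)
    then show ?thesis using that by (metis accepts_def)
  qed
  from this[of 1 1] show ?thesis
    using pm_accepts_iff[OF assms, of 1 1] pm_accepts_iff[OF assms(1) vu, of 1 1] by simp
qed

lemma pm_instance_double:
  assumes G: "pm_instance G"
  shows "pm_instance (double G)"
  unfolding pm_instance_def ug_instance_def
proof (intro conjI)
  have G': "finite (verts G)" "verts G \<noteq> {}" "edges G \<subseteq> verts G \<times> verts G" "sym (edges G)"
    "irrefl (edges G)"
    using G by (auto simp: pm_instance_def ug_instance_def)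
  show "finite (verts (double G))" "verts (double G) \<noteq> {}"
    using G' by (auto simp: double_def)
  show "edges (double G) \<subseteq> verts (double G) \<times> verts (double G)"
  proof clarify
    fix x y assume xy: "(x, y) \<in> edges (double G)"
    then obtain b u c v where "x = b # u" "y = c # v" by (rule double_edgesE)
    then show "x \<in> verts (double G) \<and> y \<in> verts (double G)"
      using xy G'(3) by (auto simp: double_edges_iff)
  qed
  show "sym (edges (double G))"
  proof (rule symI)
    fix x y assume xy: "(x, y) \<in> edges (double G)"
    then obtain b u c v where "x = b # u" "y = c # v" by (rule double_edgesE)
    then show "(y, x) \<in> edges (double G)"
      using xy G' eq_constraint_commute[OF G] by (auto simp: double_edges_iff dest: symD)
  qed
  show "irrefl (edges (double G))"
  proof (rule irreflI)
    fix x show "(x, x) \<notin> edges (double G)"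
      using G'(5) by (cases x) (auto simp: irrefl_def double_edges_iff elim: double_edgesE)
  qed
qed (auto simp: bij_betw_def)

lemma double_neq: "neq_constraint (double G) u v"
  by (auto simp: neq_constraint_def accepts_def)

lemma not_eq_constraint_double: "\<not> eq_constraint (double G) u v"
  by (auto simp: eq_constraint_def accepts_def)

lemma degree_bounded_by_double:
  assumes G: "pm_instance G" and d: "degree_bounded_by G d"
  shows "degree_bounded_by (double G) (d + 1)"
  unfolding degree_bounded_by_def vertex_degree_def
proof
  fix x assume x: "x \<in> verts (double G)"
  then obtain c v where cv: "x = c # v" "v \<in> verts G" by (cases x) auto
  let ?N = "{u. (u, v) \<in> edges G}"
  let ?f = "\<lambda>u. (if eq_constraint G u v then \<not> c else c) # u"
  have fin: "finite ?N"
    by (rule finite_subset[of _ "verts G"]) (use G in \<open>auto simp: pm_instance_def ug_instance_def\<close>)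
  \<comment> \<open>A neighbour \<open>u\<close> of \<open>v\<close> contributes only one of its
    copies, the index being forced by the kind of the constraint; the one further neighbour is the
    other copy of \<open>v\<close>.\<close>
  have "{y. (y, x) \<in> edges (double G)} \<subseteq> insert ((\<not> c) # v) (?f ` ?N)"
  proof clarify
    fix y assume y: "(y, x) \<in> edges (double G)" "y \<notin> ?f ` ?N"
    obtain b u where bu: "y = b # u" using y(1) by (rule double_edgesE)
    have "(u = v \<and> c \<noteq> b) \<or> (u \<in> ?N \<and> (c \<noteq> b \<longleftrightarrow> eq_constraint G u v))"
      using y(1) by (auto simp: bu cv double_edges_iff)
    moreover have "y = ?f u" if "c \<noteq> b \<longleftrightarrow> eq_constraint G u v"
      using that by (auto simp: bu)
    ultimately show "y = (\<not> c) # v" using y(2) bu by auto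
  qed
  then have "card {y. (y, x) \<in> edges (double G)} \<le> card (insert ((\<not> c) # v) (?f ` ?N))"
    using fin by (intro card_mono) auto
  also have "\<dots> \<le> Suc (card (?f ` ?N))"
    by (rule card_insert_le_m1) auto
  also have "\<dots> \<le> Suc (card ?N)"
    using card_image_le[OF fin] by simp
  also have "card ?N \<le> d"
    using d cv by (simp add: degree_bounded_by_def vertex_degree_def)
  finally show "card {y. (y, x) \<in> edges (double G)} \<le> d + 1" by simp
qed

section \<open>Values of the doubled instance\<close>

lemma finite_sval_set:
  assumes "finite (verts G)"
  shows "finite {real (card S) / real (card (verts G)) | S.
                   S \<subseteq> verts G \<and> strongly_satisfiable G S}"
proof -
  have "finite ((\<lambda>S. real (card S) / real (card (verts G))) ` Pow (verts G))"
    using assms by simp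
  then show ?thesis by (rule rev_finite_subset) auto
qed

lemma sval_ge:
  assumes "ug_instance G" "S \<subseteq> verts G" "strongly_satisfiable G S"
  shows "real (card S) / real (card (verts G)) \<le> sval G"
  unfolding sval_def using assms
  by (intro Max_ge finite_sval_set) (auto simp: ug_instance_def)

lemma sval_attained:
  assumes "ug_instance G"
  obtains S where "S \<subseteq> verts G" "strongly_satisfiable G S"
    "sval G = real (card S) / real (card (verts G))"
proof -
  \<comment> \<open>The empty set keeps the set under \<open>Max\<close> nonempty; a labeling exists
    because the alphabet is nonempty.\<close>
  have "strongly_satisfiable G {}"
    using assms by (auto simp: strongly_satisfiable_def ug_instance_def)
  then have "sval G \<in> {real (card S) / real (card (verts G)) | S.
                   S \<subseteq> verts G \<and> strongly_satisfiable G S}"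
    unfolding sval_def using assms
    by (intro Max_in finite_sval_set) (auto simp: ug_instance_def)
  then show ?thesis using that by auto
qed

lemma card_copies:
  fixes A :: "bool list set"
  assumes "finite A"
  shows "card (\<Union>b. Cons b ` A) = 2 * card A"
proof -
  have "(\<Union>b. Cons b ` A) = Cons False ` A \<union> Cons True ` A"
    by (auto simp: UNIV_bool)
  also have "card \<dots> = card (Cons False ` A) + card (Cons True ` A)"
    using assms by (intro card_Un_disjoint) auto
  finally show ?thesis by (simp add: card_image)
qed

lemma card_verts_double:
  assumes "pm_instance G"
  shows "card (verts (double G)) = 2 * card (verts G)"
  using assms card_copies by (auto simp: double_def pm_instance_def ug_instance_def)

text \<open>An optimal \<open>S\<close> lifts to both copies of each of its vertices, which doubles
  numerator and denominator alike.\<close>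

lemma sval_le_sval_double:
  assumes G: "pm_instance G"
  shows "sval G \<le> sval (double G)"
proof -
  have ug: "ug_instance G" and alph: "alphabet G = {1, -1}"
    using G by (auto simp: pm_instance_def)
  obtain S where S: "S \<subseteq> verts G" "strongly_satisfiable G S"
    "sval G = real (card S) / real (card (verts G))"
    using sval_attained[OF ug] .
  obtain \<sigma> where \<sigma>: "\<sigma> \<in> verts G \<rightarrow> {1, -1}"
    "\<forall>(u, v) \<in> edges G. u \<in> S \<and> v \<in> S \<longrightarrow> accepts G u v (\<sigma> u) (\<sigma> v)"
    using S(2) unfolding strongly_satisfiable_def alph by (rule bexE) (rule that)
  \<comment> \<open>The head bit is the index of the copy; negating the label at index
    \<open>True\<close> satisfies the edge between the two copies.\<close>
  let ?\<tau> = "\<lambda>x. if hd x then - \<sigma> (tl x) else \<sigma> (tl x)"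
  let ?S = "\<Union>b. Cons b ` S"
  have "strongly_satisfiable (double G) ?S"
    unfolding strongly_satisfiable_def
  proof (intro bexI[of _ ?\<tau>] ballI, clarify)
    fix x y b u c v
    assume e: "(b # u, c # v) \<in> edges (double G)" and uv: "u \<in> S" "v \<in> S"
    have lab: "\<sigma> u \<in> {1, -1}" "\<sigma> v \<in> {1, -1}" using \<sigma>(1) S(1) uv by auto
    show "accepts (double G) (b # u) (c # v) (?\<tau> (b # u)) (?\<tau> (c # v))"
    proof (cases "u = v \<and> c \<noteq> b")
      case True
      then show ?thesis by (auto simp: accepts_def)
    next
      case False
      then have uv': "(u, v) \<in> edges G" "c \<noteq> b \<longleftrightarrow> eq_constraint G u v"
        using e by (auto simp: double_edges_iff)
      \<comment> \<open>Equal labels at copies of opposite index and opposite labels at copies of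
        equal index both become opposite under \<open>?\<tau>\<close>.\<close>
      then have "\<sigma> u = \<sigma> v \<longleftrightarrow> c \<noteq> b"
        using pm_accepts_iff[OF G uv'(1) lab] \<sigma>(2) uv by auto
      then show ?thesis using lab by (auto simp: accepts_def)
    qed
  next
    show "?\<tau> \<in> verts (double G) \<rightarrow> alphabet (double G)"
      using \<sigma>(1) by (force simp: double_def)
  qed
  moreover have "?S \<subseteq> verts (double G)" using S(1) by auto
  moreover have "card ?S = 2 * card S"
    using S(1) ug by (intro card_copies) (auto simp: ug_instance_def intro: finite_subset)
  ultimately show ?thesis
    using sval_ge[of "double G" ?S] pm_instance_double[OF G] S(3) card_verts_double[OF G]
    by (simp add: pm_instance_def)
qed

text \<open>Take the vertices both of whose copies lie in an optimal set for the double, labeled as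
  their \<open>False\<close> copies. Counting copies gives
  \<open>card S \<le> card (verts G) + card ?B\<close>; dividing by \<open>card (verts G)\<close>
  gives the bound, as the double has twice as many vertices.\<close>

lemma sval_double_le:
  assumes G: "pm_instance G"
  shows "2 * sval (double G) - 1 \<le> sval G"
proof -
  have ug: "ug_instance G" and alph: "alphabet G = {1, -1}" and ug': "ug_instance (double G)"
    using G pm_instance_double[OF G] by (auto simp: pm_instance_def)
  have fin: "finite (verts G)" and pos: "card (verts G) > 0"
    using ug by (auto simp: ug_instance_def card_gt_0_iff)
  obtain S where S: "S \<subseteq> verts (double G)" "strongly_satisfiable (double G) S"
    "sval (double G) = real (card S) / real (card (verts (double G)))"
    using sval_attained[OF ug'] .
  obtain \<tau> :: "bool list \<Rightarrow> int" where \<tau>: "\<tau> \<in> verts (double G) \<rightarrow> {1, -1}"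
    and "\<forall>(x, y) \<in> edges (double G). x \<in> S \<and> y \<in> S \<longrightarrow> \<tau> x = - \<tau> y"
    using S(2) unfolding strongly_satisfiable_def accepts_def double_simps by (rule bexE) (rule that)
  then have neg: "\<tau> x = - \<tau> y" if "(x, y) \<in> edges (double G)" "x \<in> S" "y \<in> S" for x y
    using that by blast
  define A where "A b = {v. b # v \<in> S}" for b
  have A: "A b \<subseteq> verts G" for b using S(1) by (auto simp: A_def)
  then have finA: "finite (A b)" for b using fin finite_subset by blast
  let ?B = "A False \<inter> A True"
  have "S = Cons False ` A False \<union> Cons True ` A True"
  proof (intro equalityI subsetI)
    fix x assume "x \<in> S"
    moreover from this obtain b v where "x = b # v" using S(1) by (cases x) auto
    ultimately show "x \<in> Cons False ` A False \<union> Cons True ` A True"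
      by (cases b) (auto simp: A_def)
  qed (auto simp: A_def)
  then have "card S \<le> card (Cons False ` A False) + card (Cons True ` A True)"
    by (metis card_Un_le)
  also have "\<dots> = card (A False \<union> A True) + card ?B"
    using card_Un_Int[OF finA finA] by (simp add: card_image)
  also have "card (A False \<union> A True) \<le> card (verts G)"
    using A fin by (intro card_mono) auto
  finally have card: "card S \<le> card (verts G) + card ?B" by simp
  have "strongly_satisfiable G ?B"
    unfolding strongly_satisfiable_def
  proof (intro bexI[of _ "\<lambda>v. \<tau> (False # v)"] ballI, clarify)
    fix u v assume uv: "(u, v) \<in> edges G" "u \<in> A False" "v \<in> A False" "u \<in> A True" "v \<in> A True"
    have V: "u \<in> verts G" "v \<in> verts G" using uv(2,3) A by auto
    have lab: "\<tau> (False # u) \<in> {1, -1}" "\<tau> (False # v) \<in> {1, -1}" using \<tau> V by auto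
    have S': "b # u \<in> S" "b # v \<in> S" for b
      using uv by (cases b; auto simp: A_def)+
    \<comment> \<open>The kind of the constraint, a boolean, is itself the index of the copy of
      \<open>v\<close> joined to \<open>False # u\<close>.\<close>
    let ?c = "eq_constraint G u v"
    have "\<tau> (False # u) = - \<tau> (?c # v)"
      using uv by (intro neg S') (auto simp: double_edges_iff)
    \<comment> \<open>For an EQ constraint the lifted edge leads to \<open>True # v\<close>, and the
      edge between the copies of \<open>v\<close> negates a second time.\<close>
    moreover have "\<tau> (True # v) = - \<tau> (False # v)"
      using V by (intro neg S') (auto simp: double_edges_iff)
    ultimately have "\<tau> (False # u) = \<tau> (False # v) \<longleftrightarrow> ?c"
      using lab by (cases ?c) auto
    then show "accepts G u v (\<tau> (False # u)) (\<tau> (False # v))"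
      using pm_accepts_iff[OF G uv(1) lab] by simp
  next
    show "(\<lambda>v. \<tau> (False # v)) \<in> verts G \<rightarrow> alphabet G"
      using \<tau> by (auto simp: alph)
  qed
  then have "real (card ?B) / real (card (verts G)) \<le> sval G"
    using A by (intro sval_ge ug) auto
  moreover have "2 * sval (double G) - 1 \<le> real (card ?B) / real (card (verts G))"
    using card pos S(3) card_verts_double[OF G] by (simp add: field_simps)
  ultimately show ?thesis by linarith
qed

section \<open>Two-way transducers\<close>

text \<open>The new state \<open>None\<close> means halting; the last component is the symbol
  appended to the output, if any. The input is never overwritten, and its ends are recognised by
  reading a blank.\<close>

type_synonym ('q, 's) transducer = "'q \<Rightarrow> 's option \<Rightarrow> 'q option \<times> move \<times> 's option"

fun transducer_step ::
  "('q, 's) transducer \<Rightarrow> 's list \<Rightarrow> 'q option \<times> int \<times> 's list \<Rightarrow> 'q option \<times> int \<times> 's list"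
where
  "transducer_step \<delta> w (None, i, out) = (None, i, out)"
| "transducer_step \<delta> w (Some q, i, out) =
     (case \<delta> q (tape_of w i) of (q', m, s) \<Rightarrow>
        (q', i + offset m, out @ (case s of None \<Rightarrow> [] | Some x \<Rightarrow> [x])))"

definition reaches ::
  "('q, 's) transducer \<Rightarrow> 's list \<Rightarrow> nat \<Rightarrow> 'q option \<times> int \<times> 's list \<Rightarrow> 'q option \<times> int \<times> 's list \<Rightarrow> bool"
where
  "reaches \<delta> w n c c' \<longleftrightarrow> (\<exists>t \<le> n. (transducer_step \<delta> w ^^ t) c = c')"

lemma reaches_refl: "reaches \<delta> w n c c"
  unfolding reaches_def by (intro exI[of _ 0]) simp

lemma reaches_step:
  assumes "reaches \<delta> w n (transducer_step \<delta> w c) c'"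
  shows "reaches \<delta> w (Suc n) c c'"
proof -
  obtain t where "t \<le> n" "(transducer_step \<delta> w ^^ t) (transducer_step \<delta> w c) = c'"
    using assms by (auto simp: reaches_def)
  then show ?thesis
    unfolding reaches_def by (intro exI[of _ "Suc t"]) (simp add: funpow_Suc_right del: funpow.simps)
qed

lemma reaches_trans:
  assumes "reaches \<delta> w m c c'" "reaches \<delta> w n c' c''" "m + n \<le> k"
  shows "reaches \<delta> w k c c''"
proof -
  obtain s t where "s \<le> m" "(transducer_step \<delta> w ^^ s) c = c'"
    "t \<le> n" "(transducer_step \<delta> w ^^ t) c' = c''"
    using assms by (auto simp: reaches_def)
  then show ?thesis
    unfolding reaches_def using assms(3) by (intro exI[of _ "t + s"]) (simp add: funpow_add)
qed

lemma reaches_mono: "reaches \<delta> w m c c' \<Longrightarrow> m \<le> n \<Longrightarrow> reaches \<delta> w n c c'"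
  unfolding reaches_def using le_trans by blast

lemma tape_of_append_Cons [simp]: "tape_of (xs @ s # ys) (int (length xs)) = Some s"
  by (simp add: tape_of_def)

lemma tape_of_snoc: "(tape_of xs)(int (length xs) := Some s) = tape_of (xs @ [s])"
  by (auto simp: tape_of_def fun_eq_iff nth_append)

lemma tape_of_erase: "(tape_of xs)(int (length xs) := None) = tape_of xs"
  by (auto simp: tape_of_def fun_eq_iff)

text \<open>Two tapes suffice: the input tape is rewritten with what was scanned, and the output
  head stays just behind the written word. Each transducer step is one machine step, so the time
  bound carries over unchanged.\<close>

lemma transducer_tm:
  fixes \<delta> :: "('q::finite, 's::finite) transducer" and q0 :: 'q
  obtains M :: "'s tm" where "wf_tm M"
    "\<And>w T i out. reaches \<delta> w T (Some q0, 0, []) (None, i, out) \<Longrightarrow> tm_computes M w T out"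
proof -
  obtain n and f :: "'q \<Rightarrow> nat" where f: "f ` UNIV = {i. i < n}" "inj f"
    using finite_imp_inj_to_nat_seg[of "UNIV :: 'q set"] by auto
  \<comment> \<open>Machines start in state \<open>0\<close> and halt in the last state, so
    \<open>q0\<close> is numbered \<open>0\<close>, the other states are shifted up by one, and
    \<open>e'\<close> sends \<open>None\<close> to \<open>Suc n\<close>.\<close>
  define e where "e q = (if q = q0 then 0 else Suc (f q))" for q
  define e' where "e' = case_option (Suc n) e"
  have inj: "inj e" using f(2) by (auto simp: e_def inj_def)
  have fn: "f q < n" for q using f(1) by blast
  have e_less: "e q < Suc n" for q using fn[of q] by (auto simp: e_def)
  then have e'_le: "e' q \<le> Suc n" for q by (cases q) (auto simp: e'_def less_imp_le)
  define M where "M = \<lparr> n_tapes = 2, n_states = Suc n,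
    delta = (\<lambda>k ss. case \<delta> (inv e k) (hd ss) of (q', m, s) \<Rightarrow>
       (e' q', [(hd ss, m), (s, if s = None then Stay else Right)])) \<rparr>"
  have wf: "wf_tm M"
    by (auto simp: wf_tm_def M_def e'_le split: prod.splits)
  define enc where "enc w = (\<lambda>(q, i, out). (e' q, [(i, tape_of w), (int (length out), tape_of out)]))"
    for w :: "'s list"
  have step: "tm_step M (enc w c) = enc w (transducer_step \<delta> w c)" for w c
  proof -
    obtain q i out where c: "c = (q, i, out)" by (cases c)
    show ?thesis
    proof (cases q)
      case None
      then show ?thesis by (simp add: c enc_def tm_step_def M_def e'_def)
    next
      case (Some k)
      obtain q' m s where d: "\<delta> k (tape_of w i) = (q', m, s)" by (metis prod_cases3)
      have "e' (Some k) \<noteq> Suc n" using e_less[of k] by (simp add: e'_def)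
      moreover have "inv e (e' (Some k)) = k" using inj by (simp add: e'_def)
      moreover have "(tape_of w)(i := tape_of w i) = tape_of w" by simp
      ultimately show ?thesis
        using Some d
        by (cases s) (simp_all add: c enc_def tm_step_def M_def tape_of_snoc tape_of_erase)
    qed
  qed
  have steps: "(tm_step M ^^ t) (enc w c) = enc w ((transducer_step \<delta> w ^^ t) c)" for t w c
    by (induction t) (simp_all add: step)
  have init: "tm_init M w = enc w (Some q0, 0, [])" for w
    by (simp add: tm_init_def M_def enc_def e'_def e_def upt_conv_Cons)
  have "tm_computes M w T out" if r: "reaches \<delta> w T (Some q0, 0, []) (None, i, out)" for w T i out
  proof -
    obtain t where "t \<le> T" "(transducer_step \<delta> w ^^ t) (Some q0, 0, []) = (None, i, out)"
      using r by (auto simp: reaches_def)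
    then show ?thesis
      unfolding tm_computes_def init steps
      by (intro exI[of _ t]) (simp add: enc_def e'_def M_def)
  qed
  with wf show ?thesis by (rule that)
qed

section \<open>A transducer doubling an instance\<close>

text \<open>
  The parameters \<open>e\<close> and \<open>b\<close> of a state tell the current pass: edges or vertices, and the index of
  the copies. A name is written with first bit \<open>b\<close> in the states \<open>Tag1\<close> and \<open>Copy1\<close>, and the second
  name of an edge with first bit \<open>c\<close> in the states \<open>Tag2\<close> and \<open>Copy2\<close>. Between the two, the
  parameter \<open>r\<close> makes the head return to the name just read.
\<close>

datatype state =
    Seek bool bool
  | Tag1 bool bool bool
  | Copy1 bool bool bool
  | Back bool bool
  | Tag2 bool bool bool
  | Copy2 bool bool
  | Rewind bool bool

instance state :: finite
proof
  let ?R =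
    "range (\<lambda>(e, b). Seek e b) \<union> range (\<lambda>(b, c, r). Tag1 b c r) \<union> range (\<lambda>(b, c, r). Copy1 b c r) \<union>
     range (\<lambda>(b, c). Back b c) \<union> range (\<lambda>(e, b, c). Tag2 e b c) \<union> range (\<lambda>(e, b). Copy2 e b) \<union>
     range (\<lambda>(e, b). Rewind e b)"
  have "q \<in> ?R" for q by (cases q) (auto simp: image_iff)
  then have "UNIV \<subseteq> ?R" by blast
  moreover have "finite ?R" by (intro finite_UnI finite_imageI finite)
  ultimately show "finite (UNIV :: state set)" by (rule finite_subset)
qed

abbreviation bit_symbol :: "bool \<Rightarrow> symbol" where
  "bit_symbol b \<equiv> (if b then One else Zero)"

text \<open>Vertex passes come first because a representation lists all vertices before any
  edge.\<close>

fun next_pass :: "bool \<Rightarrow> bool \<Rightarrow> state option" where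
  "next_pass e False = Some (Seek e True)"
| "next_pass False True = Some (Seek True False)"
| "next_pass True True = None"

text \<open>The kind of an input edge enters only through the index \<open>c\<close> of its second
  end, \<open>\<not> b\<close> for EQ and \<open>b\<close> for NEQ; the marker written is always
  \<open>Edge_NEQ\<close>. The tag states write without moving, as the added bit has no counterpart
  in the input.\<close>

fun doubler :: "(state, symbol) transducer" where
  "doubler (Seek e b) None = (Some (Rewind e b), Left, None)"
| "doubler (Seek False b) (Some Vertex) = (Some (Tag2 False b b), Right, Some Vertex)"
| "doubler (Seek True b) (Some Vertex) = (Some (Tag1 b (\<not> b) True), Right, Some Edge_NEQ)"
| "doubler (Seek True b) (Some Edge_EQ) = (Some (Tag1 b (\<not> b) False), Right, Some Edge_NEQ)"
| "doubler (Seek True b) (Some Edge_NEQ) = (Some (Tag1 b b False), Right, Some Edge_NEQ)"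
| "doubler (Seek e b) (Some _) = (Some (Seek e b), Right, None)"
| "doubler (Tag1 b c r) _ = (Some (Copy1 b c r), Stay, Some (bit_symbol b))"
| "doubler (Copy1 b c r) (Some Stop) =
     (if r then (Some (Back b c), Left, Some Stop) else (Some (Tag2 True b c), Right, Some Stop))"
| "doubler (Copy1 b c r) s = (Some (Copy1 b c r), Right, s)"
| "doubler (Back b c) (Some Vertex) = (Some (Tag2 True b c), Right, None)"
| "doubler (Back b c) _ = (Some (Back b c), Left, None)"
| "doubler (Tag2 e b c) _ = (Some (Copy2 e b), Stay, Some (bit_symbol c))"
| "doubler (Copy2 e b) (Some Stop) = (Some (Seek e b), Right, Some Stop)"
| "doubler (Copy2 e b) s = (Some (Copy2 e b), Right, s)"
| "doubler (Rewind e b) None = (next_pass e b, Right, None)"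
| "doubler (Rewind e b) (Some _) = (Some (Rewind e b), Left, None)"

section \<open>Runs of the doubler over a single name, and the return to the start\<close>

abbreviation runs ::
  "symbol list \<Rightarrow> nat \<Rightarrow> state option \<times> int \<times> symbol list \<Rightarrow> state option \<times> int \<times> symbol list \<Rightarrow> bool"
where
  "runs \<equiv> reaches doubler"

lemma name_code_Nil [simp]: "name_code [] = [Stop]"
  and name_code_Cons [simp]: "name_code (b # v) = bit_symbol b # name_code v"
  and length_name_code [simp]: "length (name_code v) = Suc (length v)"
  by (simp_all add: name_code_def)

text \<open>Each bit read moves from the name to the prefix \<open>xs\<close> and to the output, so
  the induction generalizes over both. The extra step copies \<open>Stop\<close>.\<close>

lemma copy2_name:
  "w = xs @ name_code v @ ys \<Longrightarrow>
   runs w (Suc (length v)) (Some (Copy2 e b), int (length xs), out)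
     (Some (Seek e b), int (length xs + Suc (length v)), out @ name_code v)"
proof (induction v arbitrary: xs out)
  case Nil
  then show ?case by (intro reaches_step) (simp add: reaches_refl add.commute)
next
  case (Cons a v)
  from Cons.IH[of "xs @ [bit_symbol a]" "out @ [bit_symbol a]"] Cons.prems show ?case
    by (cases a; intro reaches_step; simp add: add_ac)
qed

lemma tag2_name:
  assumes "w = xs @ name_code v @ ys"
  shows "runs w (length v + 2) (Some (Tag2 e b c), int (length xs), out)
     (Some (Seek e b), int (length xs + Suc (length v)), out @ name_code (c # v))"
  using copy2_name[OF assms, of e b "out @ [bit_symbol c]"]
    reaches_step[of doubler w "Suc (length v)"] by simp

text \<open>With \<open>r\<close> the head turns left at \<open>Stop\<close>. The subtraction is
  made in \<open>int\<close>, since the position is \<open>-1\<close> when prefix and name are both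
  empty.\<close>

lemma copy1_name:
  "w = xs @ name_code v @ ys \<Longrightarrow>
   runs w (Suc (length v)) (Some (Copy1 b c r), int (length xs), out)
     (if r then (Some (Back b c), int (length xs + length v) - 1, out @ name_code v)
      else (Some (Tag2 True b c), int (length xs + Suc (length v)), out @ name_code v))"
proof (induction v arbitrary: xs out)
  case Nil
  then show ?case by (intro reaches_step) (simp add: reaches_refl add.commute)
next
  case (Cons a v)
  from Cons.IH[of "xs @ [bit_symbol a]" "out @ [bit_symbol a]"] Cons.prems show ?case
    by (cases a; cases r; intro reaches_step; simp add: add_ac)
qed

lemma tag1_name:
  assumes "w = xs @ name_code v @ ys"
  shows "runs w (length v + 2) (Some (Tag1 b c r), int (length xs), out)
     (if r then (Some (Back b c), int (length xs + length v) - 1, out @ name_code (b # v))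
      else (Some (Tag2 True b c), int (length xs + Suc (length v)), out @ name_code (b # v)))"
  using copy1_name[OF assms, of b c r "out @ [bit_symbol b]"]
    reaches_step[of doubler w "Suc (length v)"] by (cases r) simp_all

text \<open>The head starts on the last bit, or on the marker if the name is empty, and moves left;
  hence the induction from the right end, with the bits already passed absorbed into
  \<open>ys\<close>.\<close>

lemma back_name:
  "w = xs @ Vertex # map bit_symbol v @ ys \<Longrightarrow>
   runs w (Suc (length v)) (Some (Back b c), int (length xs + length v), out)
     (Some (Tag2 True b c), int (Suc (length xs)), out)"
proof (induction v arbitrary: ys rule: rev_induct)
  case Nil
  then show ?case by (intro reaches_step) (simp add: reaches_refl add.commute)
next
  case (snoc a v)
  have "tape_of w (int (length xs + length (v @ [a]))) = Some (bit_symbol a)"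
    using tape_of_append_Cons[of "xs @ Vertex # map bit_symbol v" "bit_symbol a" ys] snoc.prems
    by (simp add: add_ac)
  with snoc.IH[of "bit_symbol a # ys"] snoc.prems show ?case
    by (cases a; intro reaches_step; simp add: add_ac)
qed

text \<open>The blank at position \<open>-1\<close> marks the left end; it is the starting cell when
  \<open>i = 0\<close>.\<close>

lemma rewind:
  assumes "i \<le> length w"
  shows "runs w (Suc i) (Some (Rewind e b), int i - 1, out) (next_pass e b, 0, out)"
  using assms
proof (induction i)
  case 0
  then show ?case by (intro reaches_step) (simp add: reaches_refl tape_of_def)
next
  case (Suc i)
  then have "tape_of w (int i) = Some (w ! i)" by (simp add: tape_of_def)
  with Suc show ?case by (intro reaches_step[of _ _ "Suc i"]) simp
qed

section \<open>Runs over items and over the whole input\<close>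

datatype item = Vertex_Item "bool list" | Edge_Item bool "bool list" "bool list"

text \<open>An item stores the kind of its edge, so that runs are analysed on words without
  mentioning a game.\<close>

fun item_code :: "item \<Rightarrow> symbol list" where
  "item_code (Vertex_Item v) = vertex_code v"
| "item_code (Edge_Item k u v) = (if k then Edge_EQ else Edge_NEQ) # name_code u @ name_code v"

fun item_output :: "bool \<Rightarrow> bool \<Rightarrow> item \<Rightarrow> symbol list" where
  "item_output False b (Vertex_Item v) = vertex_code (b # v)"
| "item_output False b (Edge_Item k u v) = []"
| "item_output True b (Vertex_Item v) = Edge_NEQ # name_code (b # v) @ name_code ((\<not> b) # v)"
| "item_output True b (Edge_Item k u v) =
     Edge_NEQ # name_code (b # u) @ name_code ((if k then \<not> b else b) # v)"

lemma seek_skip: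
  "w = xs @ zs @ ys \<Longrightarrow> set zs \<subseteq> {Zero, One, Stop, Edge_EQ, Edge_NEQ} \<Longrightarrow>
   runs w (length zs) (Some (Seek False b), int (length xs), out)
     (Some (Seek False b), int (length xs + length zs), out)"
proof (induction zs arbitrary: xs)
  case Nil
  then show ?case by (simp add: reaches_refl)
next
  case (Cons z zs)
  then have "doubler (Seek False b) (Some z) = (Some (Seek False b), Right, None)" by auto
  with Cons.IH[of "xs @ [z]"] Cons.prems show ?case
    by (simp only: length_Cons) (intro reaches_step, simp add: add_ac)
qed

text \<open>Relative to code length, the slowest case is a vertex in an edge pass, whose name is
  traversed forth, back and forth again: \<open>3 * length v + 6\<close> steps for a code of length
  \<open>length v + 2\<close>. The factor \<open>4\<close> leaves slack in every case.\<close>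

lemma run_item:
  assumes w: "w = xs @ item_code x @ ys"
  shows "runs w (4 * length (item_code x)) (Some (Seek e b), int (length xs), out)
     (Some (Seek e b), int (length xs + length (item_code x)), out @ item_output e b x)"
proof (cases x)
  case x: (Vertex_Item v)
  have w1: "w = (xs @ [Vertex]) @ name_code v @ ys" using w x by (simp add: vertex_code_def)
  have w2: "w = xs @ Vertex # map bit_symbol v @ (Stop # ys)"
    using w x by (simp add: vertex_code_def name_code_def)
  show ?thesis
  proof (cases e)
    case False
    have "runs w (Suc (length v + 2)) (Some (Seek e b), int (length xs), out)
        (Some (Seek e b), int (length xs + length (item_code x)), out @ item_output e b x)"
      using tag2_name[OF w1, of False b b "out @ [Vertex]"] False x w2
      by (intro reaches_step) (simp add: vertex_code_def add_ac)
    then show ?thesis by (rule reaches_mono) (simp add: x vertex_code_def)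
  next
    case True
    have "runs w (Suc (length v + 2)) (Some (Seek True b), int (length xs), out)
        (Some (Back b (\<not> b)), int (length xs + length v), out @ Edge_NEQ # name_code (b # v))"
      using tag1_name[OF w1, of b "\<not> b" True "out @ [Edge_NEQ]"] w2
      by (intro reaches_step) (simp add: add_ac)
    moreover have "runs w (Suc (length v))
        (Some (Back b (\<not> b)), int (length xs + length v), out @ Edge_NEQ # name_code (b # v))
        (Some (Tag2 True b (\<not> b)), int (length (xs @ [Vertex])), out @ Edge_NEQ # name_code (b # v))"
      using back_name[OF w2, of b "\<not> b" "out @ Edge_NEQ # name_code (b # v)"] by simp
    moreover note tag2_name[OF w1, of True b "\<not> b" "out @ Edge_NEQ # name_code (b # v)"]
    ultimately have "runs w (Suc (length v + 2) + Suc (length v) + (length v + 2))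
        (Some (Seek True b), int (length xs), out)
        (Some (Seek True b), int (length (xs @ [Vertex]) + Suc (length v)),
         (out @ Edge_NEQ # name_code (b # v)) @ name_code ((\<not> b) # v))"
      using reaches_trans[OF reaches_trans[OF _ _ order_refl] _ order_refl] by blast
    then have "runs w (Suc (length v + 2) + Suc (length v) + (length v + 2))
        (Some (Seek e b), int (length xs), out)
        (Some (Seek e b), int (length xs + length (item_code x)), out @ item_output e b x)"
      by (simp add: x True vertex_code_def add_ac)
    then show ?thesis by (rule reaches_mono) (simp add: x vertex_code_def)
  qed
next
  case x: (Edge_Item k u v)
  let ?m = "if k then Edge_EQ else Edge_NEQ"
  let ?c = "if k then \<not> b else b"
  have w1: "w = (xs @ [?m]) @ name_code u @ (name_code v @ ys)" using w x by simp
  have w2: "w = (xs @ [?m] @ name_code u) @ name_code v @ ys" using w x by simp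
  show ?thesis
  proof (cases e)
    case False
    have "runs w (length (item_code x)) (Some (Seek False b), int (length xs), out)
        (Some (Seek False b), int (length xs + length (item_code x)), out)"
      by (rule seek_skip[OF w]) (auto simp: x name_code_def split: if_splits)
    then have "runs w (4 * length (item_code x)) (Some (Seek False b), int (length xs), out)
        (Some (Seek False b), int (length xs + length (item_code x)), out)"
      by (rule reaches_mono) simp
    then show ?thesis using False x by simp
  next
    case True
    have "transducer_step doubler w (Some (Seek e b), int (length xs), out) =
        (Some (Tag1 b ?c False), int (length (xs @ [?m])), out @ [Edge_NEQ])"
      using w1 True by (cases k) simp_all
    then have "runs w (Suc (length u + 2)) (Some (Seek e b), int (length xs), out)
        (Some (Tag2 True b ?c), int (length (xs @ [?m] @ name_code u)), (out @ [Edge_NEQ]) @ name_code (b # u))"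
      using tag1_name[OF w1, of b ?c False "out @ [Edge_NEQ]"]
      by (intro reaches_step) (simp add: add_ac)
    moreover note tag2_name[OF w2, of True b ?c "(out @ [Edge_NEQ]) @ name_code (b # u)"]
    ultimately have "runs w (Suc (length u + 2) + (length v + 2))
        (Some (Seek e b), int (length xs), out)
        (Some (Seek True b), int (length (xs @ [?m] @ name_code u) + Suc (length v)),
         ((out @ [Edge_NEQ]) @ name_code (b # u)) @ name_code (?c # v))"
      by (rule reaches_trans) simp
    then have "runs w (Suc (length u + 2) + (length v + 2))
        (Some (Seek e b), int (length xs), out)
        (Some (Seek e b), int (length xs + length (item_code x)), out @ item_output e b x)"
      by (simp add: x True add_ac)
    then show ?thesis by (rule reaches_mono) (simp add: x)
  qed
qed

lemma run_items:
  "w = xs @ concat (map item_code items) @ ys \<Longrightarrow>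
   runs w (4 * length (concat (map item_code items))) (Some (Seek e b), int (length xs), out)
     (Some (Seek e b), int (length xs + length (concat (map item_code items))),
      out @ concat (map (item_output e b) items))"
proof (induction items arbitrary: xs out)
  case Nil
  then show ?case by (simp add: reaches_refl)
next
  case (Cons x items)
  from Cons.prems have w1: "w = xs @ item_code x @ (concat (map item_code items) @ ys)" by simp
  from Cons.prems have w2: "w = (xs @ item_code x) @ concat (map item_code items) @ ys" by simp
  from reaches_trans[OF run_item[OF w1, of e b out] Cons.IH[OF w2, of "out @ item_output e b x",
        unfolded length_append] order_refl]
  show ?case by (simp add: algebra_simps)
qed

text \<open>The items take \<open>4 * length w\<close> steps, noticing the end takes one, and
  rewinding takes \<open>length w + 1\<close>.\<close>

lemma run_pass:
  assumes w: "w = concat (map item_code items)"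
  shows "runs w (5 * length w + 2) (Some (Seek e b), 0, out)
     (next_pass e b, 0, out @ concat (map (item_output e b) items))"
proof -
  let ?out = "out @ concat (map (item_output e b) items)"
  have "runs w (4 * length w) (Some (Seek e b), 0, out) (Some (Seek e b), int (length w), ?out)"
    using run_items[of w "[]" items "[]" e b out] w by simp
  moreover have "runs w (Suc (Suc (length w))) (Some (Seek e b), int (length w), ?out)
      (next_pass e b, 0, ?out)"
  proof (rule reaches_step)
    have "tape_of w (int (length w)) = None" by (simp add: tape_of_def)
    then show "runs w (Suc (length w))
        (transducer_step doubler w (Some (Seek e b), int (length w), ?out)) (next_pass e b, 0, ?out)"
      using rewind[of "length w" w e b ?out] by simp
  qed
  ultimately show ?thesis by (rule reaches_trans) simp
qed

definition doubler_output :: "item list \<Rightarrow> symbol list" where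
  "doubler_output items =
     concat (map (item_output False False) items) @ concat (map (item_output False True) items) @
     concat (map (item_output True False) items) @ concat (map (item_output True True) items)"

lemma run_doubler:
  assumes w: "w = concat (map item_code items)"
  shows "runs w (20 * length w + 8) (Some (Seek False False), 0, []) (None, 0, doubler_output items)"
proof -
  let ?n = "5 * length w + 2"
  let ?o = "\<lambda>e b. concat (map (item_output e b) items)"
  note pass = run_pass[OF w]
  have "runs w ?n (Some (Seek False False), 0, []) (Some (Seek False True), 0, ?o False False)"
    using pass[of False False "[]"] by simp
  moreover have "runs w ?n (Some (Seek False True), 0, ?o False False)
      (Some (Seek True False), 0, ?o False False @ ?o False True)"
    using pass[of False True "?o False False"] by simp
  moreover have "runs w ?n (Some (Seek True False), 0, ?o False False @ ?o False True)
      (Some (Seek True True), 0, (?o False False @ ?o False True) @ ?o True False)"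
    using pass[of True False "?o False False @ ?o False True"] by simp
  moreover have "runs w ?n (Some (Seek True True), 0, (?o False False @ ?o False True) @ ?o True False)
      (None, 0, doubler_output items)"
    using pass[of True True "(?o False False @ ?o False True) @ ?o True False"]
    by (simp add: doubler_output_def)
  ultimately have "runs w (?n + ?n + ?n + ?n) (Some (Seek False False), 0, []) (None, 0, doubler_output items)"
    by (meson reaches_trans order_refl)
  then show ?thesis by (rule reaches_mono) simp
qed

section \<open>Doubling in polynomial time\<close>

lemma represents_double:
  assumes G: "pm_instance G" and vs: "distinct vs" "set vs = verts G"
    and es: "distinct es" "set es = edges G"
  shows "represents
     (doubler_output (map Vertex_Item vs @ map (\<lambda>(u, v). Edge_Item (eq_constraint G u v) u v) es))
     (double G)"
proof -
  define vs' where "vs' = map (Cons False) vs @ map (Cons True) vs"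
  define es\<^sub>b where "es\<^sub>b b = map (copy_edge b) vs @ map (double_edge G b) es" for b
  define es' where "es' = es\<^sub>b False @ es\<^sub>b True"
  have irr: "(u, u) \<notin> edges G" for u
    using G by (auto simp: pm_instance_def ug_instance_def irrefl_def)
  have "distinct vs'" "set vs' = verts (double G)"
    using vs by (auto simp: vs'_def double_def distinct_map UNIV_bool)
  moreover have "distinct es'"
  proof -
    have "inj_on (copy_edge b) A" "inj_on (double_edge G b) B" for b A B
      by (auto simp: inj_on_def copy_edge_def double_edge_def)
    \<comment> \<open>An edge between copies repeats one name, which irreflexivity of
      \<open>edges G\<close> excludes for lifted edges.\<close>
    moreover have "copy_edge b ` A \<inter> double_edge G b ` edges G = {}" for b A
      using irr by (auto simp: copy_edge_def double_edge_def)
    ultimately have "distinct (es\<^sub>b b)" for b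
      using vs es by (simp add: es\<^sub>b_def distinct_map)
    \<comment> \<open>The first bit of the starting copy separates the lists of the two edge
      passes.\<close>
    moreover have "hd (fst e) = b" if "e \<in> set (es\<^sub>b b)" for e b
      using that by (auto simp: es\<^sub>b_def copy_edge_def double_edge_def)
    ultimately show ?thesis unfolding es'_def distinct_append by blast
  qed
  moreover have "set es' = edges (double G)"
    using vs es by (auto simp: es'_def es\<^sub>b_def double_def UNIV_bool)
  moreover have "doubler_output
      (map Vertex_Item vs @ map (\<lambda>(u, v). Edge_Item (eq_constraint G u v) u v) es) =
    concat (map vertex_code vs') @ concat (map (edge_code (double G)) es')"
  proof -
    have V: "concat (map (item_output False b)
        (map Vertex_Item vs @ map (\<lambda>(u, v). Edge_Item (eq_constraint G u v) u v) es)) =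
        concat (map vertex_code (map (Cons b) vs))" for b
      by (simp add: comp_def case_prod_unfold)
    \<comment> \<open>\<open>edge_code\<close> tests for EQ in the double, which negation never
      satisfies, so it yields the marker \<open>Edge_NEQ\<close> that the transducer writes.\<close>
    have "item_output True b (Vertex_Item v) = edge_code (double G) (copy_edge b v)" for b v
      by (simp add: edge_code_def copy_edge_def not_eq_constraint_double)
    moreover have "item_output True b (Edge_Item (eq_constraint G u v) u v) =
        edge_code (double G) (double_edge G b (u, v))" for b u v
      by (simp add: edge_code_def double_edge_def not_eq_constraint_double)
    ultimately have E: "concat (map (item_output True b)
        (map Vertex_Item vs @ map (\<lambda>(u, v). Edge_Item (eq_constraint G u v) u v) es)) =
        concat (map (edge_code (double G)) (es\<^sub>b b))" for b
      by (simp add: es\<^sub>b_def comp_def case_prod_unfold del: item_output.simps)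
    show ?thesis
      unfolding doubler_output_def V E by (simp add: vs'_def es'_def)
  qed
  ultimately show ?thesis unfolding represents_def by blast
qed

lemma efficient_procedure_double: "efficient_procedure double"
proof -
  obtain M :: "symbol tm" where wf: "wf_tm M" and M:
    "\<And>w T i out. runs w T (Some (Seek False False), 0, []) (None, i, out) \<Longrightarrow> tm_computes M w T out"
    using transducer_tm[of doubler "Seek False False"] by blast
  \<comment> \<open>The polynomial is \<open>20 * n + 8\<close>, the cost of four passes of
    \<open>5 * n + 2\<close> steps.\<close>
  have "\<exists>w'. tm_computes M w (poly [:8, 20:] (length w)) w' \<and> represents w' (double G)"
    if G: "pm_instance G" and w: "represents w G" for G w
  proof -
    obtain vs es where vs: "distinct vs" "set vs = verts G" and es: "distinct es" "set es = edges G"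
      and w: "w = concat (map vertex_code vs) @ concat (map (edge_code G) es)"
      using w by (auto simp: represents_def)
    let ?items = "map Vertex_Item vs @ map (\<lambda>(u, v). Edge_Item (eq_constraint G u v) u v) es"
    have "edge_code G = (\<lambda>(u, v). item_code (Edge_Item (eq_constraint G u v) u v))"
      by (auto simp: edge_code_def fun_eq_iff)
    then have "w = concat (map item_code ?items)"
      using w by (simp add: comp_def case_prod_unfold)
    then have "tm_computes M w (20 * length w + 8) (doubler_output ?items)"
      by (rule M[OF run_doubler])
    then show ?thesis
      using represents_double[OF G vs es] by (auto simp: add.commute mult.commute)
  qed
  with wf show ?thesis
    unfolding efficient_procedure_def polytime_computable_def by blast
qed

theorem theorem10p1:
  shows "\<exists>\<psi> :: pm_game \<Rightarrow> pm_game. efficient_procedure \<psi> \<and>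
    (\<forall>(G :: pm_game) (d :: nat). pm_instance G \<and> degree_bounded_by G d \<longrightarrow>
       pm_instance (\<psi> G) \<and>
       (\<forall>(\<epsilon> :: real) (\<gamma> :: real). 0 < \<epsilon> \<and> \<epsilon> < 1 \<and> 0 < \<gamma> \<and> \<gamma> < 1 \<longrightarrow>
          (sval G \<ge> 1 - \<epsilon> \<longrightarrow> sval (\<psi> G) \<ge> 1 - \<epsilon>) \<and>
          (sval (\<psi> G) \<ge> 1 - \<gamma> \<longrightarrow> sval G \<ge> 1 - 2 * \<gamma>)) \<and>
       degree_bounded_by (\<psi> G) (d + 1) \<and>
       (\<forall>(u, v) \<in> edges (\<psi> G). neq_constraint (\<psi> G) u v))"
proof (intro exI[of _ double] conjI allI impI)
  fix G :: pm_game and d :: nat and \<epsilon> \<gamma> :: real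
  assume A: "pm_instance G \<and> degree_bounded_by G d"
  then have G: "pm_instance G" by simp
  show "pm_instance (double G)" "degree_bounded_by (double G) (d + 1)"
    using A pm_instance_double degree_bounded_by_double by auto
  show "\<forall>(u, v) \<in> edges (double G). neq_constraint (double G) u v"
    by (simp add: double_neq)
  show "sval (double G) \<ge> 1 - \<epsilon>" if "sval G \<ge> 1 - \<epsilon>"
    using that sval_le_sval_double[OF G] by linarith
  show "sval G \<ge> 1 - 2 * \<gamma>" if "sval (double G) \<ge> 1 - \<gamma>"
    using that sval_double_le[OF G] by linarith
qed (rule efficient_procedure_double)

end
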